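(* Let $G$ be a $2$-connected graph, let $u$ and $v$ be vertices of $G$, and let $\mathcal{C}$ be a set of cycles of $G$. If $\mathcal{C}$ is $\Delta^*$-dense, then $\mathcal{P}_{\mathcal{C}}(G_{uv})$ is connected.
   Context: For a path $L$ and vertices $x,y$ on $L$, $L_{xy}$ denotes the subpath of $L$ joining $x$ and $y$. For vertices $u,v$ of a $2$-connected graph $G$, the $uv$ path graph $\mathcal{P}(G_{uv})$ has as vertices the paths in $G$ joining $u$ and $v$, where two such paths $S$ and $T$ are adjacent if $T$ is obtained from $S$ by replacing a subpath $S_{xy}$ of $S$ with a subpath $T_{xy}$ of $T$ internally disjoint from $S_{xy}$; in that case $S\cup T$ contains a unique cycle, namely $S\Delta T$ (where $F\Delta H$ is the subgraph induced by the edges in exactly one of $F,H$). For a set $\mathcal{C}$ of cycles of $G$, $\mathcal{P}_\mathcal{C}(G_{uv})$ is the spanning subgraph of $\mathcal{P}(G_{uv})$ in which adjacent paths $S,T$ remain adjacent if and only if the unique cycle contained in $S\cup T$ belongs to $\mathcal{C}$. A unicycle of $G$ is a spanning subgraph of $G$ containing a unique cycle. A cycle $\sigma$ of $G$ has Property $\Delta^*$ with respect to a set of cycles $\mathcal{D}$ if for every unicycle $\mathcal{U}$ containing $\sigma$ there exist an edge $e$ of $G$ not in $\mathcal{U}$ and two cycles $\alpha,\beta\in\mathcal{D}$, both contained in $\mathcal{U}+e$, with $\sigma=\alpha\Delta\beta$. The closure $Cl(\mathcal{C})$ is obtained by setting $\mathcal{C}_0=\mathcal{C}$ and, as long as some cycle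 $\sigma_{t+1}\notin\mathcal{C}_t$ has Property $\Delta^*$ with respect to $\mathcal{C}_t$, setting $\mathcal{C}_{t+1}=\mathcal{C}_t\cup\{\sigma_{t+1}\}$; $Cl(\mathcal{C})$ is the final set $\mathcal{C}_k$ when no such cycle exists (this final set is known not to depend on the choices made). $\mathcal{C}$ is $\Delta^*$-dense if $Cl(\mathcal{C})$ is the set of all cycles of $G$. *)

theory Defs
  imports Main
begin

section \<open>Graphs\<close>

text \<open>A graph is a pair of a vertex set and a set of edges, each edge a two-element set of vertices.\<close>

type_synonym 'a graph = "'a set \<times> 'a set set"

abbreviation verts :: "'a graph \<Rightarrow> 'a set" where "verts \<equiv> fst"
abbreviation edges :: "'a graph \<Rightarrow> 'a set set" where "edges \<equiv> snd"

definition simple_graph :: "'a graph \<Rightarrow> bool" where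
  "simple_graph G \<longleftrightarrow> finite (verts G) \<and> (\<forall>e \<in> edges G. e \<subseteq> verts G \<and> card e = 2)"

definition subgraph :: "'a graph \<Rightarrow> 'a graph \<Rightarrow> bool" where
  "subgraph H G \<longleftrightarrow> verts H \<subseteq> verts G \<and> edges H \<subseteq> edges G"

definition graph_union :: "'a graph \<Rightarrow> 'a graph \<Rightarrow> 'a graph" where
  "graph_union F H = (verts F \<union> verts H, edges F \<union> edges H)"

definition sym_diff_graph :: "'a graph \<Rightarrow> 'a graph \<Rightarrow> 'a graph" where
  "sym_diff_graph F H =
    (let D = (edges F - edges H) \<union> (edges H - edges F) in (\<Union>D, D))"

definition add_edge :: "'a graph \<Rightarrow> 'a set \<Rightarrow> 'a graph" where
  "add_edge H e = (verts H \<union> e, insert e (edges H))"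

definition delete_vertex :: "'a graph \<Rightarrow> 'a \<Rightarrow> 'a graph" where
  "delete_vertex G x = (verts G - {x}, {e \<in> edges G. x \<notin> e})"

section \<open>Paths, cycles and connectivity\<close>

definition path_edges :: "'a list \<Rightarrow> 'a set set" where
  "path_edges p = {{p ! i, p ! Suc i} | i. Suc i < length p}"

definition path_subgraph :: "'a list \<Rightarrow> 'a graph" where
  "path_subgraph p = (set p, path_edges p)"

text \<open>Listing the vertices from \<open>u\<close> to \<open>v\<close> represents each path joining \<open>u\<close> and \<open>v\<close> exactly once.\<close>

definition paths_between :: "'a graph \<Rightarrow> 'a \<Rightarrow> 'a \<Rightarrow> 'a list set" where
  "paths_between G u v =
    {p. p \<noteq> [] \<and> hd p = u \<and> last p = v \<and> distinct p \<and> subgraph (path_subgraph p) G}"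

definition connected_graph :: "'a graph \<Rightarrow> bool" where
  "connected_graph G \<longleftrightarrow>
    verts G \<noteq> {} \<and> (\<forall>x \<in> verts G. \<forall>y \<in> verts G. paths_between G x y \<noteq> {})"

definition two_connected :: "'a graph \<Rightarrow> bool" where
  "two_connected G \<longleftrightarrow>
    simple_graph G \<and> card (verts G) \<ge> 3 \<and> connected_graph G \<and>
    (\<forall>x \<in> verts G. connected_graph (delete_vertex G x))"

definition is_cycle :: "'a graph \<Rightarrow> bool" where
  "is_cycle C \<longleftrightarrow>
    (\<exists>p. length p \<ge> 3 \<and> distinct p \<and> C = (set p, insert {last p, hd p} (path_edges p)))"

definition cycles :: "'a graph \<Rightarrow> 'a graph set" where
  "cycles G = {C. is_cycle C \<and> subgraph C G}"

section \<open>Path graphs\<close>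

text \<open>
  \<open>S\<close> and \<open>T\<close> agree up to \<open>x\<close> and from \<open>y\<close> on, and the interiors \<open>s\<close>, \<open>t\<close> of their \<open>x\<close>-\<open>y\<close>
  subpaths are disjoint. The case \<open>s = t = []\<close>, in which nothing is replaced, is excluded by
  \<open>S \<noteq> T\<close>.
\<close>

definition path_exchange :: "'a list \<Rightarrow> 'a list \<Rightarrow> bool" where
  "path_exchange S T \<longleftrightarrow> S \<noteq> T \<and>
    (\<exists>a x s t y b. S = a @ [x] @ s @ [y] @ b \<and> T = a @ [x] @ t @ [y] @ b \<and> set s \<inter> set t = {})"

definition uv_path_graph :: "'a graph \<Rightarrow> 'a \<Rightarrow> 'a \<Rightarrow> 'a list graph" where
  "uv_path_graph G u v =
    (paths_between G u v,
     {{S, T} | S T. S \<in> paths_between G u v \<and> T \<in> paths_between G u v \<and> path_exchange S T})"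

definition uv_path_graph_by :: "'a graph set \<Rightarrow> 'a graph \<Rightarrow> 'a \<Rightarrow> 'a \<Rightarrow> 'a list graph" where
  "uv_path_graph_by \<C> G u v =
    (verts (uv_path_graph G u v),
     {{S, T} | S T. {S, T} \<in> edges (uv_path_graph G u v) \<and>
        (\<exists>\<sigma> \<in> \<C>. cycles (graph_union (path_subgraph S) (path_subgraph T)) = {\<sigma>})})"

section \<open>Closure and density\<close>

definition unicycle :: "'a graph \<Rightarrow> 'a graph \<Rightarrow> bool" where
  "unicycle G U \<longleftrightarrow> verts U = verts G \<and> edges U \<subseteq> edges G \<and> (\<exists>!\<sigma>. \<sigma> \<in> cycles U)"

definition property_Delta_star :: "'a graph \<Rightarrow> 'a graph set \<Rightarrow> 'a graph \<Rightarrow> bool" where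
  "property_Delta_star G \<D> \<sigma> \<longleftrightarrow>
    (\<forall>U. unicycle G U \<and> subgraph \<sigma> U \<longrightarrow>
      (\<exists>e \<in> edges G - edges U. \<exists>\<alpha> \<in> \<D>. \<exists>\<beta> \<in> \<D>.
        subgraph \<alpha> (add_edge U e) \<and> subgraph \<beta> (add_edge U e) \<and> \<sigma> = sym_diff_graph \<alpha> \<beta>))"

definition closure_step :: "'a graph \<Rightarrow> 'a graph set \<Rightarrow> 'a graph set \<Rightarrow> bool" where
  "closure_step G \<D> \<D>' \<longleftrightarrow>
    (\<exists>\<sigma> \<in> cycles G - \<D>. property_Delta_star G \<D> \<sigma> \<and> \<D>' = insert \<sigma> \<D>)"

definition final_closure :: "'a graph \<Rightarrow> 'a graph set \<Rightarrow> 'a graph set \<Rightarrow> bool" where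
  "final_closure G \<C> \<D> \<longleftrightarrow> (closure_step G)\<^sup>*\<^sup>* \<C> \<D> \<and> (\<nexists>\<D>'. closure_step G \<D> \<D>')"

text \<open>Well defined for finite \<open>G\<close> by \<open>ex1_final_closure\<close> below.\<close>

definition Cl :: "'a graph \<Rightarrow> 'a graph set \<Rightarrow> 'a graph set" where
  "Cl G \<C> = (THE \<D>. final_closure G \<C> \<D>)"

definition Delta_star_dense :: "'a graph \<Rightarrow> 'a graph set \<Rightarrow> bool" where
  "Delta_star_dense G \<C> \<longleftrightarrow> Cl G \<C> = cycles G"

lemma property_Delta_star_mono:
  "property_Delta_star G \<D> \<sigma> \<Longrightarrow> \<D> \<subseteq> \<D>' \<Longrightarrow> property_Delta_star G \<D>' \<sigma>"
  unfolding property_Delta_star_def by (meson subsetD)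

lemma final_closure_least:
  assumes "(closure_step G)\<^sup>*\<^sup>* \<C> \<D>" and "\<C> \<subseteq> \<E>" and "\<nexists>\<E>'. closure_step G \<E> \<E>'"
  shows "\<D> \<subseteq> \<E>"
  using assms(1)
proof (induction rule: rtranclp_induct)
  case base
  show ?case by (rule assms(2))
next
  case (step \<D> \<D>')
  then obtain \<sigma> where \<sigma>: "\<sigma> \<in> cycles G" "property_Delta_star G \<D> \<sigma>" "\<D>' = insert \<sigma> \<D>"
    unfolding closure_step_def by blast
  then have "property_Delta_star G \<E> \<sigma>"
    using property_Delta_star_mono step.IH by blast
  then have "\<sigma> \<in> \<E>"
    using assms(3) \<sigma>(1) unfolding closure_step_def by blast
  then show ?case
    using \<sigma>(3) step.IH by blast
qed

lemma closure_steps_superset: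
  "(closure_step G)\<^sup>*\<^sup>* \<C> \<D> \<Longrightarrow> \<C> \<subseteq> \<D>"
  by (induction rule: rtranclp_induct) (auto simp: closure_step_def)

lemma final_closure_unique:
  "final_closure G \<C> \<D> \<Longrightarrow> final_closure G \<C> \<E> \<Longrightarrow> \<D> = \<E>"
  unfolding final_closure_def
  by (meson closure_steps_superset final_closure_least subset_antisym)

lemma finite_cycles:
  assumes "simple_graph G"
  shows "finite (cycles G)"
proof -
  have "edges G \<subseteq> Pow (verts G)" and fin: "finite (verts G)"
    using assms by (auto simp: simple_graph_def)
  then have "finite (edges G)"
    by (meson finite_Pow_iff finite_subset)
  moreover have "cycles G \<subseteq> Pow (verts G) \<times> Pow (edges G)"
    by (auto simp: cycles_def subgraph_def)
  ultimately show ?thesis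
    using fin by (meson finite_Pow_iff finite_SigmaI finite_subset)
qed

lemma final_closure_exists:
  assumes "simple_graph G"
  shows "\<exists>\<D>. final_closure G \<C> \<D>"
proof (induction "card (cycles G - \<C>)" arbitrary: \<C> rule: less_induct)
  case less
  show ?case
  proof (cases "\<exists>\<D>. closure_step G \<C> \<D>")
    case True
    then obtain \<D> \<sigma> where step: "closure_step G \<C> \<D>" and \<sigma>: "\<sigma> \<in> cycles G - \<C>" "\<D> = insert \<sigma> \<C>"
      unfolding closure_step_def by blast
    have "cycles G - \<D> \<subset> cycles G - \<C>"
      using \<sigma> by blast
    then have "card (cycles G - \<D>) < card (cycles G - \<C>)"
      using finite_cycles[OF assms] by (simp add: psubset_card_mono)
    then obtain \<E> where "final_closure G \<D> \<E>"
      using less by blast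
    then have "final_closure G \<C> \<E>"
      using step unfolding final_closure_def by (meson converse_rtranclp_into_rtranclp)
    then show ?thesis ..
  next
    case False
    then show ?thesis
      unfolding final_closure_def by blast
  qed
qed

lemma ex1_final_closure:
  "simple_graph G \<Longrightarrow> \<exists>!\<D>. final_closure G \<C> \<D>"
  using final_closure_exists final_closure_unique by blast

end

theory Submission
  imports Defs
begin

text \<open>
  Any \<open>u\<close>-\<open>v\<close> path can be turned into any other by exchanges that lengthen the common initial
  segment, so exchanges through arbitrary cycles connect all paths. It remains to undo the closure
  one cycle at a time: an exchange of \<open>S\<close> for \<open>T\<close> through a cycle \<open>\<sigma>\<close> with Property \<open>\<Delta>\<^sup>*\<close> must be
  simulated by exchanges through the older cycles. Take the edge \<open>e\<close> and the cycles \<open>\<alpha>\<close>, \<open>\<beta>\<close> that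
  the property provides for the unicycle \<open>S \<union> T\<close>. Since \<open>\<alpha> \<noteq> \<beta>\<close>, the ends of \<open>e\<close> do not both lie on
  the same common segment of \<open>S\<close> and \<open>T\<close>, and then some \<open>u\<close>-\<open>v\<close> path \<open>R\<close> in \<open>S \<union> T + e\<close> uses \<open>e\<close> and
  is exchangeable with both \<open>S\<close> and \<open>T\<close>. The cycles of these two exchanges contain \<open>e\<close>, and the only
  nonempty edge sets of \<open>S \<union> T + e\<close> with all degrees even are \<open>\<sigma>\<close>, \<open>\<alpha>\<close> and \<open>\<beta>\<close>; hence they are among
  \<open>\<alpha>\<close> and \<open>\<beta>\<close>.
\<close>

section \<open>Edge sets with even degrees\<close>

text \<open>Addition in the binary cycle space.\<close>

definition sdiff :: "'b set \<Rightarrow> 'b set \<Rightarrow> 'b set" where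
  "sdiff A B = (A - B) \<union> (B - A)"

definition deg :: "'a set set \<Rightarrow> 'a \<Rightarrow> nat" where
  "deg F w = card {e \<in> F. w \<in> e}"

text \<open>The elements of the binary cycle space. Finiteness is demanded because
  \<open>card\<close> gives infinite sets the even value 0.\<close>

definition even_set :: "'a set set \<Rightarrow> bool" where
  "even_set F \<longleftrightarrow> finite F \<and> (\<forall>w. even (deg F w))"

text \<open>Acyclicity, phrased through the cycle space so that parity arguments apply without
  constructing cycles.\<close>

definition forest :: "'a set set \<Rightarrow> bool" where
  "forest E \<longleftrightarrow> (\<forall>F. F \<subseteq> E \<longrightarrow> even_set F \<longrightarrow> F = {})"

lemma even_card_sdiff:
  assumes "finite A" "finite B"
  shows "even (card (sdiff A B)) \<longleftrightarrow> (even (card A) \<longleftrightarrow> even (card B))"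
proof -
  have "card (sdiff A B) = card (A - B) + card (B - A)"
    unfolding sdiff_def using assms by (intro card_Un_disjoint) auto
  moreover have "card A = card (A \<inter> B) + card (A - B)" "card B = card (B \<inter> A) + card (B - A)"
    using assms by (simp_all add: card_Int_Diff)
  ultimately show ?thesis by (simp add: Int_commute) presburger
qed

lemma even_deg_sdiff:
  assumes "finite A" "finite B"
  shows "even (deg (sdiff A B) w) \<longleftrightarrow> (even (deg A w) \<longleftrightarrow> even (deg B w))"
proof -
  have "{e \<in> sdiff A B. w \<in> e} = sdiff {e \<in> A. w \<in> e} {e \<in> B. w \<in> e}"
    by (auto simp: sdiff_def)
  then show ?thesis
    using assms by (simp add: deg_def even_card_sdiff)
qed

lemma even_set_sdiff: "even_set A \<Longrightarrow> even_set B \<Longrightarrow> even_set (sdiff A B)"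
  unfolding even_set_def by (simp add: even_deg_sdiff) (simp add: sdiff_def)

lemma deg_insert:
  assumes "finite F" "f \<notin> F"
  shows "deg (insert f F) w = deg F w + (if w \<in> f then 1 else 0)"
proof -
  have "{e \<in> insert f F. w \<in> e} = (if w \<in> f then insert f {e \<in> F. w \<in> e} else {e \<in> F. w \<in> e})"
    by auto
  then show ?thesis
    using assms by (simp add: deg_def)
qed

text \<open>Otherwise \<open>{w, z}\<close> would be the only edge of \<open>F\<close> at
  \<open>w\<close>, which would then have degree 1.\<close>

lemma even_set_no_leaf:
  assumes "even_set F" "F \<subseteq> insert {w, z} E" "w \<notin> \<Union>E"
  shows "{w, z} \<notin> F"
proof
  assume "{w, z} \<in> F"
  then have "{e \<in> F. w \<in> e} = {{w, z}}"
    using assms by auto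
  then have "deg F w = 1" by (simp add: deg_def)
  then show False
    using assms(1) unfolding even_set_def by (metis odd_one)
qed

lemma forest_insert_leaf:
  assumes "forest E" "w \<notin> \<Union>E"
  shows "forest (insert {w, z} E)"
  unfolding forest_def
proof (intro allI impI)
  fix F assume F: "F \<subseteq> insert {w, z} E" "even_set F"
  then have "F \<subseteq> E"
    using even_set_no_leaf assms(2) by (metis subset_insert)
  then show "F = {}"
    using assms(1) F by (simp add: forest_def)
qed

text \<open>Both sets must contain \<open>f\<close>, so their sum avoids \<open>f\<close>; it is
  then an even subset of the forest, hence empty. All uniqueness statements about cycles below rest
  on this.\<close>

lemma even_set_insert_forest_unique:
  assumes "forest E" "even_set F" "even_set F'" "F \<subseteq> insert f E" "F' \<subseteq> insert f E"
    and "F \<noteq> {}" "F' \<noteq> {}"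
  shows "F = F'"
proof -
  have "f \<in> F" "f \<in> F'"
    using assms unfolding forest_def by (metis subset_insert)+
  then have "sdiff F F' \<subseteq> E"
    using assms by (auto simp: sdiff_def)
  then have "sdiff F F' = {}"
    using assms even_set_sdiff unfolding forest_def by blast
  then show ?thesis by (auto simp: sdiff_def)
qed

section \<open>Paths and cycles\<close>

lemma path_edges_Nil [simp]: "path_edges [] = {}"
  by (simp add: path_edges_def)

lemma path_edges_single [simp]: "path_edges [x] = {}"
  by (simp add: path_edges_def)

lemma path_edges_Cons_Cons [simp]:
  "path_edges (x # y # p) = insert {x, y} (path_edges (y # p))"
proof -
  have "{i. Suc i < length (x # y # p)} = insert 0 (Suc ` {i. Suc i < length (y # p)})"
    by (auto simp: image_iff less_Suc_eq_0_disj)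
  moreover have "path_edges q = (\<lambda>i. {q ! i, q ! Suc i}) ` {i. Suc i < length q}" for q :: "'a list"
    by (auto simp: path_edges_def)
  ultimately show ?thesis
    by (simp add: image_image)
qed

lemma path_edges_append: "path_edges (a @ x # b) = path_edges (a @ [x]) \<union> path_edges (x # b)"
proof (induction a)
  case (Cons z a)
  then show ?case by (cases a) auto
qed simp

lemma path_edges_snoc: "p \<noteq> [] \<Longrightarrow> path_edges (p @ [x]) = insert {last p, x} (path_edges p)"
  by (induction p rule: induct_list012) auto

lemma path_edges_rev: "path_edges (rev p) = path_edges p"
proof (induction p rule: induct_list012)
  case (3 x y zs)
  have "path_edges (rev (x # y # zs)) = insert {y, x} (path_edges (rev (y # zs)))"
    using path_edges_snoc[of "rev (y # zs)" x] by simp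
  then show ?case using 3 by (simp add: insert_commute)
qed auto

lemma finite_path_edges [simp]: "finite (path_edges p)"
  by (induction p rule: induct_list012) auto

lemma path_edges_subset: "e \<in> path_edges p \<Longrightarrow> e \<subseteq> set p"
  by (induction p rule: induct_list012) auto

lemma Union_path_edges: "length p \<ge> 2 \<Longrightarrow> \<Union>(path_edges p) = set p"
proof (induction p rule: induct_list012)
  case (3 x y zs)
  then show ?case by (cases zs) auto
qed auto

section \<open>Acyclicity and degree parity of paths\<close>

text \<open>The path is built backwards from \<open>y\<close>, which may lie on \<open>E\<close>:
  each vertex of \<open>t\<close> is new and is attached as a leaf.\<close>

lemma forest_path_edges_append:
  assumes "forest E" "distinct (t @ [y])" "set t \<inter> \<Union>E = {}"
  shows "forest (E \<union> path_edges (t @ [y]))"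
  using assms
proof (induction t)
  case (Cons z t)
  \<comment> \<open>\<open>k\<close> is the successor of \<open>z\<close> on the path, namely
    \<open>y\<close> if \<open>t\<close> is empty.\<close>
  define k where "k = hd (t @ [y])"
  have eq: "path_edges (z # t @ [y]) = insert {z, k} (path_edges (t @ [y]))"
    by (cases t) (auto simp: k_def)
  have "z \<notin> \<Union>(E \<union> path_edges (t @ [y]))"
    using Cons.prems path_edges_subset[of _ "t @ [y]"] by fastforce
  then show ?case
    using Cons forest_insert_leaf[of "E \<union> path_edges (t @ [y])" z k] by (simp add: eq)
qed simp

lemma forest_path_edges:
  assumes "distinct p"
  shows "forest (path_edges p)"
proof (cases p rule: rev_cases)
  case (snoc t y)
  have "forest {}" by (simp add: forest_def)
  from forest_path_edges_append[OF this, of t y] show ?thesis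
    using snoc assms by simp
qed (simp add: forest_def)

text \<open>The conjunct \<open>hd p \<noteq> last p\<close> accounts for the one-vertex path, which
  has no edges.\<close>

lemma odd_deg_path_edges:
  "distinct p \<Longrightarrow> p \<noteq> [] \<Longrightarrow>
    odd (deg (path_edges p) w) \<longleftrightarrow> hd p \<noteq> last p \<and> (w = hd p \<or> w = last p)"
proof (induction p rule: induct_list012)
  case (3 x y zs)
  have "{x, y} \<notin> path_edges (y # zs)"
    using 3(3) path_edges_subset by fastforce
  moreover have "x \<noteq> last (y # zs)"
    using 3(3) last_in_set[of "y # zs"] by auto
  ultimately show ?case
    using 3 by (auto simp: deg_insert split: if_splits)
qed (auto simp: deg_def)

text \<open>Both paths have the same vertices of odd degree, so the parities cancel.\<close>

lemma even_set_sdiff_path_edges: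
  assumes "distinct S" "distinct T" "S \<noteq> []" "T \<noteq> []" "hd S = hd T" "last S = last T"
  shows "even_set (sdiff (path_edges S) (path_edges T))"
  unfolding even_set_def
  using assms odd_deg_path_edges[of S] odd_deg_path_edges[of T]
  by (auto simp: even_deg_sdiff) (auto simp: sdiff_def)

section \<open>Cycles as minimal even edge sets\<close>

text \<open>The closing edge flips the parity at the two ends only. With at least three vertices it
  is not already a path edge.\<close>

lemma even_set_closed_path:
  assumes "distinct p" "length p \<ge> 3"
  shows "even_set (insert {last p, hd p} (path_edges p))"
proof -
  obtain x y z r where p: "p = x # y # z # r"
    using assms(2) by (auto simp: numeral_3_eq_3 Suc_le_length_iff)
  have ne: "last p \<noteq> x" "last p \<noteq> y"
    using assms(1) last_in_set[of "z # r"] by (auto simp: p)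
  then have "{last p, hd p} \<notin> path_edges p"
    using assms(1) path_edges_subset[of "{last p, hd p}" "y # z # r"]
    by (auto simp: p doubleton_eq_iff)
  then have "even (deg (insert {last p, hd p} (path_edges p)) w)" for w
    using odd_deg_path_edges[of p w] assms(1) ne(1) p
    by (subst deg_insert) (simp_all del: path_edges_Cons_Cons last.simps, metis+)
  then show ?thesis
    by (simp add: even_set_def)
qed

lemma is_cycle_even_set: "is_cycle C \<Longrightarrow> even_set (edges C)"
  by (auto simp: is_cycle_def even_set_closed_path)

lemma is_cycle_edges_nonempty: "is_cycle C \<Longrightarrow> edges C \<noteq> {}"
  by (auto simp: is_cycle_def)

text \<open>A cycle has no isolated vertices; hence cycles can be compared by their edges
  alone.\<close>

lemma is_cycle_verts: "is_cycle C \<Longrightarrow> verts C = \<Union>(edges C)"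
proof -
  assume "is_cycle C"
  then obtain p where p: "length p \<ge> 3" "C = (set p, insert {last p, hd p} (path_edges p))"
    by (auto simp: is_cycle_def)
  then have "p \<noteq> []" by auto
  then show ?thesis
    using p Union_path_edges[of p] by auto
qed

lemma is_cycle_eq: "is_cycle C \<Longrightarrow> is_cycle C' \<Longrightarrow> edges C = edges C' \<Longrightarrow> C = C'"
  by (metis is_cycle_verts prod.expand)

text \<open>A cycle is a path, hence a forest, plus one closing edge, so it has only one nonempty
  even subset.\<close>

lemma is_cycle_minimal:
  assumes "is_cycle C" "even_set F" "F \<subseteq> edges C" "F \<noteq> {}"
  shows "F = edges C"
proof -
  obtain p where p: "distinct p" "edges C = insert {last p, hd p} (path_edges p)"
    using assms(1) by (auto simp: is_cycle_def)
  show ?thesis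
    using even_set_insert_forest_unique[OF forest_path_edges[OF p(1)] assms(2)
        is_cycle_even_set[OF assms(1)], of "{last p, hd p}"] assms(3,4)
      is_cycle_edges_nonempty[OF assms(1)] p(2) by simp
qed

lemma two_points_split:
  assumes "p \<in> set r" "q \<in> set r" "p \<noteq> q"
  obtains a c b where "r = a @ p # c @ q # b" | a c b where "r = a @ q # c @ p # b"
proof -
  obtain a b where r: "r = a @ p # b"
    using assms(1) by (meson split_list)
  then consider "q \<in> set a" | "q \<in> set b"
    using assms by auto
  then show ?thesis
  proof cases
    case 1
    then obtain a1 a2 where "a = a1 @ q # a2" by (meson split_list)
    then show ?thesis using that(2)[of a1 a2 b] r by simp
  next
    case 2
    then obtain b1 b2 where "b = b1 @ q # b2" by (meson split_list)
    then show ?thesis using that(1)[of a b1 b2] r by simp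
  qed
qed

text \<open>\<open>D\<close> is the segment between \<open>p\<close> and \<open>q\<close>. It has an
  interior vertex because the chord is not a path edge, so the chord closes it to a cycle.\<close>

lemma even_set_chord_of_path:
  assumes "distinct r" "p \<in> set r" "q \<in> set r" "p \<noteq> q" "{p, q} \<notin> path_edges r"
  shows "\<exists>D \<subseteq> path_edges r. even_set (insert {p, q} D)"
proof -
  have main: "\<exists>D \<subseteq> path_edges r. even_set (insert {p, q} D)"
    if r: "r = a @ p # c @ q # b" and ne: "{p, q} \<notin> path_edges r" for a b c p q
  proof -
    have sub: "path_edges (p # c @ [q]) \<subseteq> path_edges r"
      using path_edges_append[of a p "c @ q # b"] path_edges_append[of "p # c" q b] r by auto
    then have "c \<noteq> []" using ne by auto
    then have "even_set (insert {q, p} (path_edges (p # c @ [q])))"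
      using even_set_closed_path[of "p # c @ [q]"] assms(1) r by (cases c) auto
    then show ?thesis using sub by (metis insert_commute)
  qed
  show ?thesis
  proof (rule two_points_split[OF assms(2-4)])
    show ?thesis if "r = a @ p # c @ q # b" for a b c
      using main[OF that assms(5)] .
    show ?thesis if "r = a @ q # c @ p # b" for a b c
      using main[OF that] assms(5) by (simp add: insert_commute)
  qed
qed

section \<open>Path exchanges\<close>

lemma path_exchange_sym: "path_exchange S T \<Longrightarrow> path_exchange T S"
  unfolding path_exchange_def by (metis inf_commute)

lemma path_exchangeE:
  assumes "path_exchange S T"
  obtains a x s t y b where "S = a @ x # s @ y # b" "T = a @ x # t @ y # b"
    "set s \<inter> set t = {}" "S \<noteq> T"
proof -
  obtain a x s t y b where "S = a @ [x] @ s @ [y] @ b" "T = a @ [x] @ t @ [y] @ b"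
    "set s \<inter> set t = {}"
    using assms unfolding path_exchange_def by blast
  then show ?thesis
    using that[of a x s y b t] assms by (simp add: path_exchange_def)
qed

lemma path_exchange_ends:
  assumes "path_exchange S T"
  shows "S \<noteq> []" "T \<noteq> []" "hd S = hd T" "last S = last T"
proof -
  obtain a x s t y b where *: "S = a @ x # s @ y # b" "T = a @ x # t @ y # b"
    "set s \<inter> set t = {}" "S \<noteq> T"
    using assms by (rule path_exchangeE)
  show "S \<noteq> []" "T \<noteq> []" "last S = last T" by (simp_all add: *)
  show "hd S = hd T" by (cases a) (simp_all add: *)
qed

text \<open>Adding the \<open>t\<close>-part of \<open>T\<close> to \<open>S\<close> from
  \<open>y\<close> backwards keeps a forest; only the edge of \<open>T\<close> leaving
  \<open>x\<close> is then missing. Uniqueness is proved for all even sets, not just for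
  cycles.\<close>

lemma path_exchange_cycle:
  assumes "path_exchange S T" "distinct S" "distinct T"
  obtains \<sigma> where "is_cycle \<sigma>" "edges \<sigma> \<subseteq> path_edges S \<union> path_edges T"
    "\<And>F. F \<subseteq> path_edges S \<union> path_edges T \<Longrightarrow> even_set F \<Longrightarrow> F \<noteq> {} \<Longrightarrow> F = edges \<sigma>"
proof -
  obtain a x s t y b where S: "S = a @ x # s @ y # b" and T: "T = a @ x # t @ y # b"
    and st: "set s \<inter> set t = {}" and "S \<noteq> T"
    using assms(1) by (rule path_exchangeE)
  then have ne: "s \<noteq> [] \<or> t \<noteq> []" by auto
  \<comment> \<open>The cycle runs from \<open>x\<close> along \<open>s\<close> to \<open>y\<close>
    and back along \<open>t\<close>.\<close>
  define c where "c = x # s @ y # rev t"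
  define \<sigma> where "\<sigma> = (set c, insert {last c, hd c} (path_edges c))"
  have c: "distinct c" "length c \<ge> 3"
    using assms S T st ne by (auto simp: c_def Suc_le_eq)
  then have cyc: "is_cycle \<sigma>"
    by (auto simp: \<sigma>_def is_cycle_def)
  have "edges \<sigma> = path_edges (c @ [x])"
    using path_edges_snoc[of c x] by (simp add: \<sigma>_def c_def)
  also have "\<dots> = path_edges (x # s @ [y]) \<union> path_edges (y # rev t @ [x])"
    using path_edges_append[of "x # s" y "rev t @ [x]"] by (simp add: c_def)
  also have "path_edges (y # rev t @ [x]) = path_edges (x # t @ [y])"
    using path_edges_rev[of "x # t @ [y]"] by simp
  finally have edges: "edges \<sigma> = path_edges (x # s @ [y]) \<union> path_edges (x # t @ [y])" .
  have dec: "path_edges (a @ x # r @ y # b) =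
      path_edges (a @ [x]) \<union> path_edges (x # r @ [y]) \<union> path_edges (y # b)" for r
    using path_edges_append[of a x "r @ y # b"] path_edges_append[of "x # r" y b] by auto
  have sub: "edges \<sigma> \<subseteq> path_edges S \<union> path_edges T"
    using edges dec[of s] dec[of t] by (auto simp: S T)
  \<comment> \<open>The edge by which \<open>T\<close> leaves \<open>x\<close>; it ends in
    \<open>y\<close> if \<open>t\<close> is empty.\<close>
  define f where "f = {x, hd (t @ [y])}"
  have "path_edges (x # t @ [y]) = insert f (path_edges (t @ [y]))"
    by (cases t) (auto simp: f_def)
  then have U: "path_edges S \<union> path_edges T = insert f (path_edges S \<union> path_edges (t @ [y]))"
    using dec[of s] dec[of t] by (auto simp: S T)
  have "set t \<inter> \<Union>(path_edges S) = {}"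
  proof -
    have "set t \<inter> set S = {}" using assms(3) st by (auto simp: S T)
    then show ?thesis using path_edges_subset[of _ S] by blast
  qed
  then have "forest (path_edges S \<union> path_edges (t @ [y]))"
    using forest_path_edges_append[OF forest_path_edges[OF assms(2)]] assms(3) by (auto simp: T)
  then have "F = edges \<sigma>" if "F \<subseteq> path_edges S \<union> path_edges T" "even_set F" "F \<noteq> {}" for F
    using even_set_insert_forest_unique[OF _ that(2) is_cycle_even_set[OF cyc]]
      that(1,3) is_cycle_edges_nonempty[OF cyc] sub unfolding U by simp
  then show ?thesis using that cyc sub by blast
qed

text \<open>If \<open>s\<close> is nonempty, its first vertex is not on \<open>T\<close>, so the
  edge from \<open>x\<close> to it distinguishes the paths; the case of \<open>t\<close> is
  symmetric.\<close>

lemma path_exchange_edges_neq: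
  assumes "path_exchange S T" "distinct S" "distinct T"
  shows "path_edges S \<noteq> path_edges T"
proof -
  have main: "path_edges (a @ x # s @ y # b) \<noteq> path_edges (a @ x # t @ y # b)"
    if d: "distinct (a @ x # s @ y # b)" and "set s \<inter> set t = {}" and ne: "s \<noteq> []" for a s t b :: "'a list" and x y
  proof -
    obtain z s' where s: "s = z # s'" using ne by (cases s) auto
    then have "z \<notin> set (a @ x # t @ y # b)" using d \<open>set s \<inter> set t = {}\<close> by auto
    then have "{x, z} \<notin> path_edges (a @ x # t @ y # b)"
      using path_edges_subset[of "{x, z}"] by blast
    moreover have "{x, z} \<in> path_edges (a @ x # s @ y # b)"
      using path_edges_append[of a x "s @ y # b"] s by auto
    ultimately show ?thesis by blast
  qed
  obtain a x s t y b where S: "S = a @ x # s @ y # b" and T: "T = a @ x # t @ y # b"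
    and st: "set s \<inter> set t = {}" and "S \<noteq> T"
    using assms(1) by (rule path_exchangeE)
  then consider "s \<noteq> []" | "t \<noteq> []" by auto
  then show ?thesis
    using main[of a x s y b t] main[of a x t y b s] assms st S T by cases (auto simp: Int_commute)
qed

text \<open>The symmetric difference is a nonempty even set, so uniqueness identifies it with the
  cycle.\<close>

lemma path_exchange_cycles_union:
  assumes "path_exchange S T" "distinct S" "distinct T"
  obtains \<sigma> where "is_cycle \<sigma>"
    "edges \<sigma> = sdiff (path_edges S) (path_edges T)"
    "cycles (graph_union (path_subgraph S) (path_subgraph T)) = {\<sigma>}"
    "\<And>F. F \<subseteq> path_edges S \<union> path_edges T \<Longrightarrow> even_set F \<Longrightarrow> F \<noteq> {} \<Longrightarrow> F = edges \<sigma>"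
proof -
  obtain \<sigma> where \<sigma>: "is_cycle \<sigma>" "edges \<sigma> \<subseteq> path_edges S \<union> path_edges T"
    and uniq: "\<And>F. F \<subseteq> path_edges S \<union> path_edges T \<Longrightarrow> even_set F \<Longrightarrow> F \<noteq> {} \<Longrightarrow> F = edges \<sigma>"
    using path_exchange_cycle[OF assms] by blast
  have "sdiff (path_edges S) (path_edges T) \<noteq> {}"
    using path_exchange_edges_neq[OF assms] by (auto simp: sdiff_def)
  then have "edges \<sigma> = sdiff (path_edges S) (path_edges T)"
    using uniq[of "sdiff (path_edges S) (path_edges T)"] even_set_sdiff_path_edges
      path_exchange_ends[OF assms(1)] assms by (auto simp: sdiff_def)
  moreover have "cycles (graph_union (path_subgraph S) (path_subgraph T)) = {\<sigma>}"
  proof (rule set_eqI, unfold singleton_iff, rule iffI)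
    fix C assume "C \<in> cycles (graph_union (path_subgraph S) (path_subgraph T))"
    then have "is_cycle C" "edges C \<subseteq> path_edges S \<union> path_edges T"
      by (auto simp: cycles_def subgraph_def graph_union_def path_subgraph_def)
    then show "C = \<sigma>"
      using uniq is_cycle_even_set is_cycle_edges_nonempty is_cycle_eq \<sigma>(1) by metis
  next
    fix C assume "C = \<sigma>"
    moreover have "verts \<sigma> \<subseteq> set S \<union> set T"
      using is_cycle_verts[OF \<sigma>(1)] \<sigma>(2) path_edges_subset[of _ S] path_edges_subset[of _ T] by blast
    ultimately show "C \<in> cycles (graph_union (path_subgraph S) (path_subgraph T))"
      using \<sigma> by (auto simp: cycles_def subgraph_def graph_union_def path_subgraph_def)
  qed
  ultimately show ?thesis using that \<sigma>(1) uniq by blast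
qed

section \<open>Detours through a new edge\<close>

text \<open>\<open>path_exchange\<close> without inequality of the paths, which for detours will
  follow from the new edge \<open>e\<close>.\<close>

definition replaces :: "'a list \<Rightarrow> 'a list \<Rightarrow> bool" where
  "replaces S T \<longleftrightarrow>
    (\<exists>a x s t y b. S = a @ x # s @ y # b \<and> T = a @ x # t @ y # b \<and> set s \<inter> set t = {})"

lemma replacesI:
  "S = a @ x # s @ y # b \<Longrightarrow> T = a @ x # t @ y # b \<Longrightarrow> set s \<inter> set t = {} \<Longrightarrow> replaces S T"
  unfolding replaces_def by blast

lemma replaces_sym: "replaces S T \<Longrightarrow> replaces T S"
  unfolding replaces_def by (metis inf_commute)

lemma path_exchange_iff_replaces: "path_exchange S T \<longleftrightarrow> S \<noteq> T \<and> replaces S T"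
  by (simp add: path_exchange_def replaces_def)

text \<open>\<open>R\<close> is to be the midpoint of a two-step route from \<open>S\<close> to
  \<open>T\<close>. The last two inclusions keep it inside \<open>S \<union> T + e\<close>.\<close>

definition detour :: "'a list \<Rightarrow> 'a list \<Rightarrow> 'a set \<Rightarrow> 'a list \<Rightarrow> bool" where
  "detour S T e R \<longleftrightarrow> distinct R \<and> replaces S R \<and> replaces T R \<and> e \<in> path_edges R \<and>
    path_edges R \<subseteq> insert e (path_edges S \<union> path_edges T) \<and> set R \<subseteq> set S \<union> set T"

lemma detour_sym: "detour S T e R \<Longrightarrow> detour T S e R"
  by (auto simp: detour_def)

text \<open>\<open>R\<close> follows \<open>S\<close> or \<open>T\<close> up to \<open>p\<close>,
  crosses to \<open>q\<close>, and follows \<open>S\<close> or \<open>T\<close> from there; only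
  \<open>{p, q}\<close> can be a new edge.\<close>

lemma detourI:
  assumes "R = r1 @ p # q # r2" "r1 @ p # c \<in> {S, T}" "d @ q # r2 \<in> {S, T}"
    and "distinct R" "replaces S R" "replaces T R"
  shows "detour S T {p, q} R"
proof -
  have R: "path_edges R = insert {p, q} (path_edges (r1 @ [p]) \<union> path_edges (q # r2))"
    using path_edges_append[of r1 p "q # r2"] by (auto simp: assms(1))
  have "path_edges (r1 @ [p]) \<subseteq> path_edges (r1 @ p # c)" "path_edges (q # r2) \<subseteq> path_edges (d @ q # r2)"
    using path_edges_append[of r1 p c] path_edges_append[of d q r2] by auto
  moreover have sub: "path_edges z \<subseteq> path_edges S \<union> path_edges T" "set z \<subseteq> set S \<union> set T"
    if "z \<in> {S, T}" for z
    using that by auto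
  ultimately have "path_edges R \<subseteq> insert {p, q} (path_edges S \<union> path_edges T)"
    using sub(1)[OF assms(2)] sub(1)[OF assms(3)] unfolding R by blast
  moreover have "set R \<subseteq> set (r1 @ p # c) \<union> set (d @ q # r2)"
    by (auto simp: assms(1))
  then have "set R \<subseteq> set S \<union> set T"
    using sub(2)[OF assms(2)] sub(2)[OF assms(3)] by blast
  ultimately show ?thesis
    using assms(4-6) R by (simp add: detour_def)
qed

section \<open>Detours by the position of the ends of the new edge\<close>

context
  fixes a b s t :: "'a list" and x y :: 'a and S T
  assumes S: "S = a @ x # s @ y # b" and T: "T = a @ x # t @ y # b"
    and dist: "distinct S" "distinct T" and disj: "set s \<inter> set t = {}"
begin

text \<open>\<open>R\<close> jumps from \<open>p\<close> to \<open>q\<close>, bypassing both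
  interiors.\<close>

lemma detour_prefix_suffix:
  assumes "p \<in> set (a @ [x])" "q \<in> set (y # b)"
  shows "\<exists>R. detour S T {p, q} R"
proof -
  obtain a1 c where a1: "a @ [x] = a1 @ p # c" using assms(1) by (meson split_list)
  obtain d b2 where b2: "y # b = d @ q # b2" using assms(2) by (meson split_list)
  have pre: "a @ x # w = a1 @ p # c @ w" for w
    using arg_cong[OF a1, of "\<lambda>z. z @ w"] by simp
  have S': "S = a1 @ p # (c @ s @ d) @ q # b2" and T': "T = a1 @ p # (c @ t @ d) @ q # b2"
    by (simp_all add: S T pre b2)
  have "detour S T {p, q} (a1 @ p # q # b2)"
  proof (rule detourI[OF refl])
    show "replaces S (a1 @ p # q # b2)" "replaces T (a1 @ p # q # b2)"
      by (rule replacesI[OF S', of _ "[]"] replacesI[OF T', of _ "[]"]; simp)+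
    show "a1 @ p # (c @ s @ d) @ q # b2 \<in> {S, T}" "(a1 @ p # c @ s @ d) @ q # b2 \<in> {S, T}"
      by (simp_all add: S')
    show "distinct (a1 @ p # q # b2)" using dist(1) by (auto simp: S')
  qed
  then show ?thesis ..
qed

text \<open>\<open>R\<close> jumps into \<open>s\<close> and follows \<open>S\<close> from there.
  Compared with \<open>T\<close>, the segment \<open>c @ t\<close> gives way to
  \<open>q # s2\<close>.\<close>

lemma detour_prefix_mid:
  assumes "p \<in> set (a @ [x])" "q \<in> set s"
  shows "\<exists>R. detour S T {p, q} R"
proof -
  obtain a1 c where a1: "a @ [x] = a1 @ p # c" using assms(1) by (meson split_list)
  obtain s1 s2 where s: "s = s1 @ q # s2" using assms(2) by (meson split_list)
  have pre: "a @ x # w = a1 @ p # c @ w" for w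
    using arg_cong[OF a1, of "\<lambda>z. z @ w"] by simp
  have S': "S = a1 @ p # (c @ s1) @ q # s2 @ y # b" and T': "T = a1 @ p # (c @ t) @ y # b"
    by (simp_all add: S T pre s)
  have "detour S T {p, q} (a1 @ p # q # s2 @ y # b)"
  proof (rule detourI[OF refl])
    show "replaces S (a1 @ p # q # s2 @ y # b)"
      by (rule replacesI[OF S', of _ "[]"]; simp)
    show "replaces T (a1 @ p # q # s2 @ y # b)"
      by (rule replacesI[OF T', of _ "q # s2"]) (use dist disj S' s in auto)
    show "a1 @ p # (c @ s1) @ q # s2 @ y # b \<in> {S, T}" "(a1 @ p # c @ s1) @ q # s2 @ y # b \<in> {S, T}"
      by (simp_all add: S')
    show "distinct (a1 @ p # q # s2 @ y # b)" using dist(1) by (auto simp: S')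
  qed
  then show ?thesis ..
qed

text \<open>\<open>R\<close> follows \<open>S\<close> into \<open>s\<close> and jumps from
  \<open>p\<close> to the suffix. Compared with \<open>T\<close>, the segment \<open>t @ d\<close>
  gives way to \<open>s1 @ [p]\<close>.\<close>

lemma detour_mid_suffix:
  assumes "p \<in> set s" "q \<in> set (y # b)"
  shows "\<exists>R. detour S T {p, q} R"
proof -
  obtain s1 s2 where s: "s = s1 @ p # s2" using assms(1) by (meson split_list)
  obtain d b2 where b2: "y # b = d @ q # b2" using assms(2) by (meson split_list)
  have S': "S = (a @ x # s1) @ p # (s2 @ d) @ q # b2" and T': "T = a @ x # (t @ d) @ q # b2"
    by (simp_all add: S T s b2)
  have "detour S T {p, q} ((a @ x # s1) @ p # q # b2)"
  proof (rule detourI[OF refl])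
    show "replaces S ((a @ x # s1) @ p # q # b2)"
      by (rule replacesI[OF S', of _ "[]"]; simp)
    show "replaces T ((a @ x # s1) @ p # q # b2)"
      by (rule replacesI[OF T', of _ "s1 @ [p]"]) (use dist disj S' s in auto)
    show "(a @ x # s1) @ p # (s2 @ d) @ q # b2 \<in> {S, T}" "(a @ x # s1 @ p # s2 @ d) @ q # b2 \<in> {S, T}"
      by (simp_all add: S')
    show "distinct ((a @ x # s1) @ p # q # b2)" using dist(1) by (auto simp: S')
  qed
  then show ?thesis ..
qed

text \<open>\<open>R\<close> starts along \<open>S\<close> and crosses over to \<open>T\<close>: it
  differs from \<open>S\<close> only between \<open>p\<close> and \<open>y\<close>, from
  \<open>T\<close> only between \<open>x\<close> and \<open>q\<close>.\<close>

lemma detour_mid_other_mid: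
  assumes "p \<in> set s" "q \<in> set t"
  shows "\<exists>R. detour S T {p, q} R"
proof -
  obtain s1 s2 where s: "s = s1 @ p # s2" using assms(1) by (meson split_list)
  obtain t1 t2 where t: "t = t1 @ q # t2" using assms(2) by (meson split_list)
  have S': "S = (a @ x # s1) @ p # s2 @ y # b" and T': "T = a @ x # t1 @ q # t2 @ y # b"
    by (simp_all add: S T s t)
  have "detour S T {p, q} ((a @ x # s1) @ p # q # t2 @ y # b)"
  proof (rule detourI[OF refl])
    show "replaces S ((a @ x # s1) @ p # q # t2 @ y # b)"
      by (rule replacesI[OF S', of _ "q # t2"]) (use disj s t in auto)
    show "replaces T ((a @ x # s1) @ p # q # t2 @ y # b)"
      by (rule replacesI[OF T', of _ "s1 @ [p]"]) (use disj s t in auto)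
    show "(a @ x # s1) @ p # s2 @ y # b \<in> {S, T}" "(a @ x # t1) @ q # t2 @ y # b \<in> {S, T}"
      by (simp_all add: S' T')
    show "distinct ((a @ x # s1) @ p # q # t2 @ y # b)" using dist disj by (auto simp: S T s t)
  qed
  then show ?thesis ..
qed

text \<open>\<open>R\<close> takes a shortcut within \<open>s\<close>, and what remains of
  \<open>s\<close> is still disjoint from \<open>t\<close>.\<close>

lemma detour_mid_mid:
  assumes "s = s1 @ p # s2 @ q # s3"
  shows "\<exists>R. detour S T {p, q} R"
proof -
  have S': "S = (a @ x # s1) @ p # s2 @ q # s3 @ y # b"
    by (simp add: S assms)
  have "detour S T {p, q} ((a @ x # s1) @ p # q # s3 @ y # b)"
  proof (rule detourI[OF refl])
    show "replaces S ((a @ x # s1) @ p # q # s3 @ y # b)"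
      by (rule replacesI[OF S', of _ "[]"]; simp)
    show "replaces T ((a @ x # s1) @ p # q # s3 @ y # b)"
      by (rule replacesI[OF T, of _ "s1 @ p # q # s3"]) (use disj assms in auto)
    show "(a @ x # s1) @ p # s2 @ q # s3 @ y # b \<in> {S, T}"
      "(a @ x # s1 @ p # s2) @ q # s3 @ y # b \<in> {S, T}"
      by (simp_all add: S')
    show "distinct ((a @ x # s1) @ p # q # s3 @ y # b)" using dist(1) by (auto simp: S')
  qed
  then show ?thesis ..
qed

end

text \<open>Up to swapping \<open>p\<close> with \<open>q\<close> and \<open>S\<close> with
  \<open>T\<close>, the five preceding cases cover all positions not excluded by \<open>pre\<close>
  and \<open>suf\<close>.\<close>

lemma detour_exists:
  assumes S: "S = a @ x # s @ y # b" and T: "T = a @ x # t @ y # b"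
    and dist: "distinct S" "distinct T" and disj: "set s \<inter> set t = {}"
    and pq: "p \<noteq> q" "p \<in> set S \<union> set T" "q \<in> set S \<union> set T"
    and pre: "\<not> (p \<in> set (a @ [x]) \<and> q \<in> set (a @ [x]))"
    and suf: "\<not> (p \<in> set (y # b) \<and> q \<in> set (y # b))"
  shows "\<exists>R. detour S T {p, q} R"
proof -
  note ctx = S T dist disj
  have disj': "set t \<inter> set s = {}" using disj by blast
  note ctx' = T S dist(2,1) disj'
  \<comment> \<open>With the regions ordered as prefix, \<open>s\<close>, \<open>t\<close>, suffix,
    this treats \<open>p\<close> in an earlier region than \<open>q\<close>.\<close>
  have step: "\<exists>R. detour S T {p, q} R"
    if "p \<in> set (a @ [x]) \<and> q \<in> set s \<union> set t \<union> set (y # b) \<or>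
        p \<in> set s \<and> q \<in> set t \<union> set (y # b) \<or> p \<in> set t \<and> q \<in> set (y # b)" for p q
    using that detour_prefix_suffix[OF ctx, of p q] detour_prefix_mid[OF ctx, of p q]
      detour_mid_suffix[OF ctx, of p q] detour_mid_other_mid[OF ctx, of p q]
      detour_prefix_mid[OF ctx', of p q] detour_mid_suffix[OF ctx', of p q]
    by (metis Un_iff detour_sym)
  have mid: "\<exists>R. detour S T {p, q} R" if "p \<in> set s" "q \<in> set s"
    using two_points_split[OF that pq(1)]
      detour_mid_mid[OF ctx, of _ p _ q] detour_mid_mid[OF ctx, of _ q _ p]
    by (metis insert_commute)
  have mid': "\<exists>R. detour S T {p, q} R" if "p \<in> set t" "q \<in> set t"
    using two_points_split[OF that pq(1)]
      detour_mid_mid[OF ctx', of _ p _ q] detour_mid_mid[OF ctx', of _ q _ p]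
    by (metis insert_commute detour_sym)
  have mem: "w \<in> set S \<union> set T \<longleftrightarrow> w \<in> set (a @ [x]) \<or> w \<in> set s \<or> w \<in> set t \<or> w \<in> set (y # b)" for w
    by (auto simp: S T)
  show ?thesis
    using pq(2,3) pre suf step[of p q] step[of q p] mid mid'
    unfolding mem insert_commute[of q p] by (elim disjE) blast+
qed

section \<open>Eliminating a cycle with Property \<open>\<Delta>\<^sup>*\<close>\<close>

text \<open>Adjacency in \<open>uv_path_graph_by\<close> as a relation, so that reachability becomes
  its reflexive transitive closure.\<close>

definition exchange_via :: "'a graph set \<Rightarrow> 'a graph \<Rightarrow> 'a \<Rightarrow> 'a \<Rightarrow> 'a list \<Rightarrow> 'a list \<Rightarrow> bool" where
  "exchange_via \<D> G u v S T \<longleftrightarrow>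
    S \<in> paths_between G u v \<and> T \<in> paths_between G u v \<and> path_exchange S T \<and>
    (\<exists>\<sigma> \<in> \<D>. cycles (graph_union (path_subgraph S) (path_subgraph T)) = {\<sigma>})"

text \<open>This undoes one closure step: the exchange is replaced by two, from \<open>S\<close> to
  \<open>R\<close> and from \<open>R\<close> to \<open>T\<close>, both through cycles containing
  \<open>e\<close>.\<close>

lemma exchange_via_Delta_star:
  assumes "simple_graph G" "\<D> \<subseteq> cycles G" "property_Delta_star G \<D> \<sigma>"
    and "exchange_via {\<sigma>} G u v S T"
  shows "(exchange_via \<D> G u v)\<^sup>*\<^sup>* S T"
proof -
  have SP: "S \<in> paths_between G u v" and TP: "T \<in> paths_between G u v" and ex: "path_exchange S T"
    and c\<sigma>: "cycles (graph_union (path_subgraph S) (path_subgraph T)) = {\<sigma>}"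
    using assms(4) by (auto simp: exchange_via_def)
  have dist: "distinct S" "distinct T"
    using SP TP by (auto simp: paths_between_def)
  have inG: "set S \<subseteq> verts G" "set T \<subseteq> verts G" "path_edges S \<subseteq> edges G" "path_edges T \<subseteq> edges G"
    using SP TP by (auto simp: paths_between_def subgraph_def path_subgraph_def)
  define E where "E = path_edges S \<union> path_edges T"
  have cyc: "is_cycle \<sigma>" and \<sigma>E: "edges \<sigma> = sdiff (path_edges S) (path_edges T)"
    and uniq: "\<And>F. F \<subseteq> E \<Longrightarrow> even_set F \<Longrightarrow> F \<noteq> {} \<Longrightarrow> F = edges \<sigma>"
    using path_exchange_cycles_union[OF ex dist] c\<sigma> unfolding E_def by (metis singleton_inject)+
  have EU: "\<Union>E \<subseteq> set S \<union> set T"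
    using path_edges_subset[of _ S] path_edges_subset[of _ T] unfolding E_def by blast
  \<comment> \<open>A unicycle must span \<open>G\<close>; the vertices off \<open>S\<close> and
    \<open>T\<close> are isolated and create no further cycle.\<close>
  define U where "U = (verts G, E)"
  have \<sigma>U: "\<sigma> \<in> cycles U"
    using cyc is_cycle_verts[OF cyc] \<sigma>E EU inG
    by (auto simp: U_def cycles_def subgraph_def E_def sdiff_def)
  have "C = \<sigma>" if "C \<in> cycles U" for C
  proof -
    have C: "is_cycle C" "edges C \<subseteq> E"
      using that by (simp_all add: U_def cycles_def subgraph_def)
    show ?thesis
      using C cyc
      by (intro is_cycle_eq uniq is_cycle_even_set is_cycle_edges_nonempty)
  qed
  with \<sigma>U have "\<exists>!\<tau>. \<tau> \<in> cycles U"
    by (rule ex1I)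
  then have "unicycle G U"
    using inG by (simp add: unicycle_def U_def E_def)
  moreover have "subgraph \<sigma> U"
    using \<sigma>U by (simp add: cycles_def)
  ultimately obtain e \<alpha> \<beta> where "e \<in> edges G - edges U" and \<alpha>\<beta>: "\<alpha> \<in> \<D>" "\<beta> \<in> \<D>"
    and "subgraph \<alpha> (add_edge U e)" "subgraph \<beta> (add_edge U e)" and eq: "\<sigma> = sym_diff_graph \<alpha> \<beta>"
    using assms(3) unfolding property_Delta_star_def by blast
  then have e: "e \<in> edges G" "e \<notin> E" and sub: "edges \<alpha> \<subseteq> insert e E" "edges \<beta> \<subseteq> insert e E"
    by (simp_all add: subgraph_def add_edge_def U_def)
  have cyc\<alpha>\<beta>: "is_cycle \<alpha>" "is_cycle \<beta>"
    using \<alpha>\<beta> assms(2) by (auto simp: cycles_def)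
  have \<sigma>\<Delta>: "edges \<sigma> = sdiff (edges \<alpha>) (edges \<beta>)"
    by (simp add: eq sym_diff_graph_def sdiff_def Let_def)
  have ne: "edges \<alpha> \<noteq> {}" "edges \<beta> \<noteq> {}" "edges \<sigma> \<noteq> {}"
    using cyc cyc\<alpha>\<beta> is_cycle_edges_nonempty by blast+
  have ev: "even_set (edges \<alpha>)" "even_set (edges \<beta>)"
    using cyc\<alpha>\<beta> is_cycle_even_set by blast+
  have e\<alpha>: "e \<in> edges \<alpha>"
  proof (rule ccontr)
    assume "e \<notin> edges \<alpha>"
    then have "edges \<alpha> = edges \<sigma>"
      using uniq ev(1) ne(1) sub(1) by (metis subset_insert)
    then have "edges \<beta> = {}" using \<sigma>\<Delta> by (auto simp: sdiff_def)
    then show False using ne by simp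
  qed
  \<comment> \<open>The even subsets of \<open>E\<close> are only \<open>{}\<close> and \<open>\<sigma>\<close>, and \<open>F\<close> differs from \<open>\<alpha>\<close> by one of them.\<close>
  have key: "F = edges \<alpha> \<or> F = edges \<beta>" if "even_set F" "F \<subseteq> insert e E" "e \<in> F" for F
  proof (cases "sdiff F (edges \<alpha>) = {}")
    case True
    then show ?thesis by (auto simp: sdiff_def)
  next
    case False
    moreover have "sdiff F (edges \<alpha>) \<subseteq> E"
      using that e\<alpha> sub by (auto simp: sdiff_def)
    ultimately have "sdiff F (edges \<alpha>) = sdiff (edges \<alpha>) (edges \<beta>)"
      using uniq even_set_sdiff[OF that(1) ev(1)] \<sigma>\<Delta> by metis
    then have "F = edges \<beta>"
      unfolding sdiff_def by blast
    then show ?thesis ..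
  qed
  obtain p q where epq: "e = {p, q}" "p \<noteq> q"
    using assms(1) e(1) by (auto simp: simple_graph_def card_2_iff)
  \<comment> \<open>An end of \<open>e\<close> off both paths would be a leaf of
    \<open>\<alpha>\<close>.\<close>
  have pST: "p \<in> set S \<union> set T"
    using even_set_no_leaf[of "edges \<alpha>" p q E] ev(1) sub(1) e\<alpha> EU epq(1) by blast
  have qST: "q \<in> set S \<union> set T"
    using even_set_no_leaf[of "edges \<alpha>" q p E] ev(1) sub(1) e\<alpha> EU epq(1)
    by (metis insert_commute subsetD)
  \<comment> \<open>Otherwise \<open>e\<close> closes a cycle within the common segment \<open>r\<close>; it is \<open>\<alpha>\<close> or \<open>\<beta>\<close> and disjoint from
    \<open>\<sigma> = \<alpha> \<Delta> \<beta>\<close>, so one of \<open>\<alpha>\<close>, \<open>\<beta>\<close> contains the other.\<close>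
  have not_both: "\<not> (p \<in> set r \<and> q \<in> set r)"
    if r: "distinct r" "path_edges r \<subseteq> path_edges S \<inter> path_edges T" for r
  proof
    assume "p \<in> set r \<and> q \<in> set r"
    moreover have "{p, q} \<notin> path_edges r"
      using r e(2) epq(1) by (auto simp: E_def)
    ultimately obtain D where D: "D \<subseteq> path_edges r" "even_set (insert e D)"
      using even_set_chord_of_path[OF r(1)] epq by blast
    then have "insert e D = edges \<alpha> \<or> insert e D = edges \<beta>"
      using key[of "insert e D"] r(2) by (auto simp: E_def)
    moreover have "insert e D \<inter> edges \<sigma> = {}"
      using D(1) r(2) e(2) by (auto simp: \<sigma>E sdiff_def E_def)
    ultimately have "edges \<alpha> \<subseteq> edges \<beta> \<or> edges \<beta> \<subseteq> edges \<alpha>"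
      unfolding \<sigma>\<Delta> sdiff_def by blast
    then have "edges \<alpha> = edges \<beta>"
      using is_cycle_minimal cyc\<alpha>\<beta> ev ne by metis
    then show False using ne(3) by (simp add: \<sigma>\<Delta> sdiff_def)
  qed
  obtain a x s t y b where S: "S = a @ x # s @ y # b" and T: "T = a @ x # t @ y # b"
    and disj: "set s \<inter> set t = {}" and "S \<noteq> T"
    using ex by (rule path_exchangeE)
  \<comment> \<open>The prefix up to \<open>x\<close> and the suffix from \<open>y\<close> are the
    two common segments to which \<open>not_both\<close> is applied.\<close>
  have "path_edges (a @ [x]) \<subseteq> path_edges S \<inter> path_edges T"
    using path_edges_append[of a x "s @ y # b"] path_edges_append[of a x "t @ y # b"]
    by (simp add: S T)
  moreover have "path_edges (y # b) \<subseteq> path_edges S \<inter> path_edges T"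
    using path_edges_append[of "a @ x # s" y b] path_edges_append[of "a @ x # t" y b]
    by (simp add: S T)
  moreover have "distinct (a @ [x])" "distinct (y # b)"
    using dist(1) by (simp_all add: S)
  ultimately obtain R where "detour S T e R"
    using detour_exists[OF S T dist disj epq(2) pST qST not_both not_both] epq(1) by blast
  then have R: "distinct R" "replaces S R" "replaces T R" "e \<in> path_edges R"
    "path_edges R \<subseteq> insert e E" "set R \<subseteq> set S \<union> set T"
    by (auto simp: detour_def E_def)
  \<comment> \<open>\<open>R\<close> differs from \<open>S\<close> and \<open>T\<close> because it
    uses \<open>e\<close>.\<close>
  have exR: "path_exchange S R" "path_exchange T R"
    using R(2-4) e(2) by (auto simp: path_exchange_iff_replaces E_def)
  have RP: "R \<in> paths_between G u v"
    using path_exchange_ends[OF exR(1)] SP R inG e(1)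
    by (auto simp: paths_between_def subgraph_def path_subgraph_def E_def)
  \<comment> \<open>The cycle of such an exchange is the symmetric difference, which contains
    \<open>e\<close>; \<open>key\<close> then makes it \<open>\<alpha>\<close> or
    \<open>\<beta>\<close>.\<close>
  have adj: "\<exists>\<tau> \<in> \<D>. cycles (graph_union (path_subgraph Q) (path_subgraph Q')) = {\<tau>}"
    if Q: "path_exchange Q Q'" "distinct Q" "distinct Q'"
      "e \<in> sdiff (path_edges Q) (path_edges Q')" "path_edges Q \<union> path_edges Q' \<subseteq> insert e E" for Q Q'
  proof -
    obtain \<tau> where \<tau>: "is_cycle \<tau>" "edges \<tau> = sdiff (path_edges Q) (path_edges Q')"
      "cycles (graph_union (path_subgraph Q) (path_subgraph Q')) = {\<tau>}"
      using path_exchange_cycles_union[OF Q(1-3)] by metis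
    have "edges \<tau> \<subseteq> insert e E" using \<tau>(2) Q(5) by (auto simp: sdiff_def)
    then have "edges \<tau> = edges \<alpha> \<or> edges \<tau> = edges \<beta>"
      using key is_cycle_even_set[OF \<tau>(1)] \<tau>(2) Q(4) by simp
    then have "\<tau> \<in> \<D>"
      using is_cycle_eq \<tau>(1) cyc\<alpha>\<beta> \<alpha>\<beta> by metis
    then show ?thesis using \<tau>(3) by blast
  qed
  have "e \<in> sdiff (path_edges S) (path_edges R)" "e \<in> sdiff (path_edges R) (path_edges T)"
    "path_edges S \<union> path_edges R \<subseteq> insert e E" "path_edges R \<union> path_edges T \<subseteq> insert e E"
    using R(4,5) e(2) by (auto simp: sdiff_def E_def)
  then have "exchange_via \<D> G u v S R" "exchange_via \<D> G u v R T"
    unfolding exchange_via_def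
    using SP TP RP exR(1) path_exchange_sym[OF exR(2)] adj dist R(1) by simp_all
  then show ?thesis by (meson converse_rtranclp_into_rtranclp r_into_rtranclp)
qed

text \<open>Induction along the closure steps: an exchange through the newest cycle is first
  replaced by a walk through older cycles.\<close>

lemma exchange_via_closure:
  assumes "simple_graph G" "(closure_step G)\<^sup>*\<^sup>* \<C> \<D>" "\<D> \<subseteq> cycles G" "exchange_via \<D> G u v S T"
  shows "(exchange_via \<C> G u v)\<^sup>*\<^sup>* S T"
  using assms(2-)
proof (induction arbitrary: S T rule: rtranclp_induct)
  case base
  then show ?case by blast
next
  case (step \<D> \<D>')
  then obtain \<sigma> where \<sigma>: "property_Delta_star G \<D> \<sigma>" "\<D>' = insert \<sigma> \<D>"
    unfolding closure_step_def by blast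
  then have sub: "\<D> \<subseteq> cycles G" using step.prems by blast
  have "exchange_via \<D> G u v S T \<or> exchange_via {\<sigma>} G u v S T"
    using step.prems(2) \<sigma>(2) by (auto simp: exchange_via_def)
  then have "(exchange_via \<D> G u v)\<^sup>*\<^sup>* S T"
    using exchange_via_Delta_star[OF assms(1) sub \<sigma>(1)] by blast
  \<comment> \<open>The outer induction hypothesis applies to each exchange of this walk.\<close>
  then show ?case
  proof (induction rule: rtranclp_induct)
    case (step Q R)
    then show ?case
      using \<open>\<And>S T. \<D> \<subseteq> cycles G \<Longrightarrow> exchange_via \<D> G u v S T \<Longrightarrow> (exchange_via \<C> G u v)\<^sup>*\<^sup>* S T\<close>[OF sub]
      by (meson rtranclp_trans)
  qed simp
qed

section \<open>Connectivity\<close>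

lemma exchange_via_cyclesI:
  assumes "S \<in> paths_between G u v" "T \<in> paths_between G u v" "path_exchange S T"
  shows "exchange_via (cycles G) G u v S T"
proof -
  have "distinct S" "distinct T"
    using assms by (auto simp: paths_between_def)
  then obtain \<sigma> where \<sigma>: "cycles (graph_union (path_subgraph S) (path_subgraph T)) = {\<sigma>}"
    using path_exchange_cycles_union[OF assms(3)] by metis
  then have "\<sigma> \<in> cycles (graph_union (path_subgraph S) (path_subgraph T))" by simp
  then have "\<sigma> \<in> cycles G"
    using assms(1,2) by (auto simp: cycles_def paths_between_def subgraph_def graph_union_def)
  then show ?thesis
    using assms \<sigma> by (auto simp: exchange_via_def)
qed

text \<open>Induction on what remains of \<open>T\<close> after the common initial segment. The next
  path \<open>R\<close> follows \<open>T\<close> until it first meets the rest of \<open>S\<close>,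
  and then follows \<open>S\<close>.\<close>

lemma exchange_via_cycles_reachable:
  assumes "S \<in> paths_between G u v" "T \<in> paths_between G u v"
    and "S = a @ x # s" "T = a @ x # t"
  shows "(exchange_via (cycles G) G u v)\<^sup>*\<^sup>* S T"
  using assms
proof (induction "length t" arbitrary: S a x s t rule: less_induct)
  case less
  note SP = less.prems(1) and TP = less.prems(2) and S = less.prems(3) and T = less.prems(4)
  have dist: "distinct S" "distinct T" and last: "last S = last T"
    using SP TP by (auto simp: paths_between_def)
  show ?case
  proof (cases "s = [] \<or> t = []")
    case True
    \<comment> \<open>If one path stops at \<open>x\<close>, then \<open>x\<close> is also the last
      vertex of the other, which by distinctness stops there too.\<close>
    have "s = [] \<longleftrightarrow> t = []"
      using dist last last_in_set[of s] last_in_set[of t] by (auto simp: S T split: if_splits)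
    then show ?thesis using True S T by simp
  next
    case False
    then have "last t \<in> set s"
      using last last_in_set[of s] by (simp add: S T)
    then have "\<exists>w \<in> set t. w \<in> set s" using False last_in_set[of t] by blast
    \<comment> \<open>Taking the first vertex of \<open>t\<close> on \<open>s\<close> makes
      \<open>t1\<close> disjoint from \<open>s\<close>, as an exchange requires.\<close>
    then obtain t1 y t2 where t: "t = t1 @ y # t2" "y \<in> set s" "\<forall>w \<in> set t1. w \<notin> set s"
      using split_list_first_prop[of t "\<lambda>w. w \<in> set s"] by auto
    obtain s1 s2 where s: "s = s1 @ y # s2" using t(2) by (meson split_list)
    define R where "R = a @ x # t1 @ y # s2"
    have edg: "path_edges R \<subseteq> path_edges S \<union> path_edges T"
      using path_edges_append[of "a @ x # t1" y s2] path_edges_append[of "a @ x # t1" y t2]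
        path_edges_append[of "a @ x # s1" y s2] by (auto simp: R_def S T s t(1))
    have "distinct R"
      using dist t(3) by (auto simp: R_def S T s t(1))
    moreover have "hd R = hd S" by (cases a) (simp_all add: R_def S)
    moreover have "last R = last S" "R \<noteq> []" "set R \<subseteq> set S \<union> set T"
      by (auto simp: R_def S T s t(1))
    ultimately have RP: "R \<in> paths_between G u v"
      using SP TP edg unfolding paths_between_def subgraph_def path_subgraph_def
      by auto
    have "(exchange_via (cycles G) G u v)\<^sup>*\<^sup>* R T"
      using less.hyps[of t2 R "a @ x # t1" y s2] RP TP by (simp add: R_def T t(1))
    \<comment> \<open>\<open>S = R\<close> occurs when \<open>S\<close> and \<open>T\<close> also
      share their next vertex; the common segment still grows by \<open>y\<close>.\<close>
    moreover have "S = R \<or> exchange_via (cycles G) G u v S R"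
    proof -
      have "replaces S R"
        by (rule replacesI[of _ a x s1 y s2 _ t1]) (use t(3) in \<open>auto simp: S R_def s\<close>)
      then show ?thesis
        using exchange_via_cyclesI[OF SP RP] by (auto simp: path_exchange_iff_replaces)
    qed
    ultimately show ?thesis by (metis converse_rtranclp_into_rtranclp)
  qed
qed

text \<open>The path is extended along the walk and cut back whenever a vertex recurs. The relation
  records \<open>b \<in> verts H\<close> because edges of an arbitrary pair \<open>H\<close> need
  not join vertices of \<open>H\<close>.\<close>

lemma reachable_imp_path:
  assumes "(\<lambda>a b. {a, b} \<in> edges H \<and> b \<in> verts H)\<^sup>*\<^sup>* x y" "x \<in> verts H"
  shows "paths_between H x y \<noteq> {}"
  using assms(1)
proof (induction rule: rtranclp_induct)
  case base
  have "[x] \<in> paths_between H x x"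
    using assms(2) by (simp add: paths_between_def subgraph_def path_subgraph_def)
  then show ?case by blast
next
  case (step y z)
  then obtain p where p: "p \<noteq> []" "hd p = x" "last p = y" "distinct p"
    "set p \<subseteq> verts H" "path_edges p \<subseteq> edges H"
    by (auto simp: paths_between_def subgraph_def path_subgraph_def)
  show ?case
  proof (cases "z \<in> set p")
    case True
    then obtain p1 p2 where p12: "p = p1 @ z # p2" by (meson split_list)
    then have "p1 @ [z] \<in> paths_between H x z"
      using p path_edges_append[of p1 z p2]
      by (auto simp: paths_between_def subgraph_def path_subgraph_def hd_append)
    then show ?thesis by blast
  next
    case False
    then have "p @ [z] \<in> paths_between H x z"
      using p step.hyps(2) path_edges_snoc[OF p(1), of z]
      by (auto simp: paths_between_def subgraph_def path_subgraph_def)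
    then show ?thesis by blast
  qed
qed

theorem theorem5:
  fixes G :: "'a graph" and u v :: 'a and \<C> :: "'a graph set"
  assumes "two_connected G"
    and "u \<in> verts G" and "v \<in> verts G"
    and "\<C> \<subseteq> cycles G"
    and "Delta_star_dense G \<C>"
  shows "connected_graph (uv_path_graph_by \<C> G u v)"
proof -
  have simple: "simple_graph G" and "connected_graph G"
    using assms(1) by (auto simp: two_connected_def)
  then have nonempty: "paths_between G u v \<noteq> {}"
    using assms(2,3) by (auto simp: connected_graph_def)
  \<comment> \<open>Existence and uniqueness give the definite description \<open>Cl\<close> its
    meaning; density then yields a chain of closure steps from \<open>\<C>\<close> to all
    cycles.\<close>
  have "final_closure G \<C> (Cl G \<C>)"
    unfolding Cl_def by (rule theI'[OF ex1_final_closure[OF simple]])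
  then have closure: "(closure_step G)\<^sup>*\<^sup>* \<C> (cycles G)"
    using assms(5) by (simp add: final_closure_def Delta_star_dense_def)
  let ?P = "uv_path_graph_by \<C> G u v"
  have verts: "verts ?P = paths_between G u v"
    by (simp add: uv_path_graph_by_def uv_path_graph_def)
  have adj: "{S, T} \<in> edges ?P \<and> T \<in> verts ?P" if "exchange_via \<C> G u v S T" for S T
    using that unfolding uv_path_graph_by_def uv_path_graph_def exchange_via_def by auto
  have "paths_between ?P S T \<noteq> {}" if ST: "S \<in> paths_between G u v" "T \<in> paths_between G u v" for S T
  proof (rule reachable_imp_path)
    show "S \<in> verts ?P" using ST verts by simp
    \<comment> \<open>The common initial segment to start from consists of \<open>u\<close>
      alone.\<close>
    have "S = [] @ u # tl S" "T = [] @ u # tl T"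
      using ST unfolding paths_between_def by (cases S; cases T; simp)+
    from exchange_via_cycles_reachable[OF ST this]
    have "(exchange_via \<C> G u v)\<^sup>*\<^sup>* S T"
    proof (induction rule: rtranclp_induct)
      case (step Q R)
      then show ?case
        using exchange_via_closure[OF simple closure subset_refl] by (meson rtranclp_trans)
    qed simp
    then show "(\<lambda>S T. {S, T} \<in> edges ?P \<and> T \<in> verts ?P)\<^sup>*\<^sup>* S T"
      using adj by (rule mono_rtranclp[rule_format, rotated])
  qed
  then show ?thesis
    using nonempty verts by (simp add: connected_graph_def)
qed

end
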